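(* Let $X=\{x_1,\ldots,x_m\}\subseteq\mathbb{R}^d$ be a finite Ramsey set, and let $y\in\operatorname{conv}(X)$. If $\lambda\in\mathbb{R}$ satisfies $\lambda\neq 0$ and $|\lambda|\geq \rho_X(y)$, then $$(X\times\{0\})\cup\{(y,\lambda)\}\subseteq\mathbb{R}^{d+1}$$ is Ramsey.
   Context: All Euclidean spaces $\mathbb{R}^n$ carry the usual Euclidean norm $\lVert\cdot\rVert$ and distance. A finite set $X$ in a Euclidean space is called Ramsey if, for every positive integer $k$, there is an integer $N$ such that every $k$-colouring of $\mathbb{R}^N$ (that is, every function from $\mathbb{R}^N$ to a set of $k$ colours) contains a monochromatic isometric copy of $X$, i.e. there is a distance-preserving map $\varphi: X\to\mathbb{R}^N$ whose image has all its points of the same colour. $\operatorname{conv}(X)$ denotes the convex hull of $X$. For $X=\{x_1,\ldots,x_m\}\subseteq\mathbb{R}^d$ and $y\in\operatorname{conv}(X)$, the number $\rho_X(y)\ge 0$ is defined by $$ \rho_X(y)^2= \min\left\{ \sum_{i=1}^m p_i\lVert x_i-y\rVert^2: p_i\geq 0,\ \sum_{i=1}^m p_i=1,\ \sum_{i=1}^m p_i x_i=y \right\}; $$ the set of admissible weights $(p_1,\ldots,p_m)$ is nonempty and compact, so the minimum exists. *)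

theory Defs
  imports "HOL-Analysis.Analysis"
begin

text \<open>
  The dimension of the coloured space is quantified inside the definition of a Ramsey set, so
  it cannot be a type: the points of \<open>\<real>\<^sup>N\<close> are the real sequences that vanish from index \<open>N\<close> on
  (the carrier of the library topology \<^const>\<open>Euclidean_space\<close>).
\<close>

definition Rn :: "nat \<Rightarrow> (nat \<Rightarrow> real) set" where
  "Rn N = {x. \<forall>i\<ge>N. x i = 0}"

definition Rn_dist :: "nat \<Rightarrow> (nat \<Rightarrow> real) \<Rightarrow> (nat \<Rightarrow> real) \<Rightarrow> real" where
  "Rn_dist N x y = L2_set (\<lambda>i. x i - y i) {..<N}"

lemma topspace_Euclidean_space_eq_Rn: "topspace (Euclidean_space N) = Rn N"
  by (simp add: Rn_def topspace_Euclidean_space)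

definition euclidean_ramsey :: "'a::euclidean_space set \<Rightarrow> bool" where
  "euclidean_ramsey X \<longleftrightarrow> finite X \<and>
     (\<forall>k::nat. k \<ge> 1 \<longrightarrow>
       (\<exists>N. \<forall>c \<in> Rn N \<rightarrow> {..<k}.
         \<exists>\<phi> \<in> X \<rightarrow> Rn N.
           (\<forall>x\<in>X. \<forall>x'\<in>X. Rn_dist N (\<phi> x) (\<phi> x') = dist x x') \<and>
           (\<exists>j. \<forall>x\<in>X. c (\<phi> x) = j)))"

text \<open>Weights are indexed by the points of \<open>X\<close>; their values outside \<open>X\<close> are irrelevant.\<close>

definition admissible_weights :: "'a::euclidean_space set \<Rightarrow> 'a \<Rightarrow> ('a \<Rightarrow> real) set" where
  "admissible_weights X y =
     {p. (\<forall>x\<in>X. p x \<ge> 0) \<and> (\<Sum>x\<in>X. p x) = 1 \<and> (\<Sum>x\<in>X. p x *\<^sub>R x) = y}"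

text \<open>
  For finite \<open>X\<close> and \<open>y\<close> in its convex hull the infimum is a minimum, see \<open>rho_minimum\<close> below.
\<close>

definition rho :: "'a::euclidean_space set \<Rightarrow> 'a \<Rightarrow> real" where
  "rho X y = sqrt (INF p \<in> admissible_weights X y. \<Sum>x\<in>X. p x * (norm (x - y))\<^sup>2)"

lemma admissible_weights_nonempty:
  assumes "finite X" and "y \<in> convex hull X"
  shows "admissible_weights X y \<noteq> {}"
  using assms by (auto simp: admissible_weights_def convex_hull_finite)

lemma rho_minimum:
  assumes "finite X" and "y \<in> convex hull X"
  shows "rho X y \<ge> 0"
    and "\<exists>p \<in> admissible_weights X y. (rho X y)\<^sup>2 = (\<Sum>x\<in>X. p x * (norm (x - y))\<^sup>2)"
    and "\<And>q. q \<in> admissible_weights X y \<Longrightarrow> (rho X y)\<^sup>2 \<le> (\<Sum>x\<in>X. q x * (norm (x - y))\<^sup>2)"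
proof -
  define F where "F p = (\<Sum>x\<in>X. p x * (norm (x - y))\<^sup>2)" for p :: "'a \<Rightarrow> real"
  define K where "K = PiE X (\<lambda>_. {0..1::real})"
  have K: "compact K"
  proof -
    have "compactin (product_topology (\<lambda>_. euclidean) UNIV)
            (PiE UNIV (\<lambda>x. if x \<in> X then {0..1::real} else {undefined}))"
      by (subst compactin_PiE) auto
    moreover have "PiE UNIV (\<lambda>x. if x \<in> X then {0..1::real} else {undefined}) = K"
      by (auto simp: K_def PiE_def Pi_def extensional_def split: if_splits)
    ultimately show ?thesis
      by (simp add: euclidean_product_topology)
  qed
  have coord: "continuous_on UNIV (\<lambda>p::'a \<Rightarrow> real. p x)" for x
    by (rule continuous_on_product_coordinates)
  have contF: "continuous_on UNIV F"
    unfolding F_def by (intro continuous_intros coord)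
  have closed: "closed {p::'a \<Rightarrow> real. (\<Sum>x\<in>X. p x) = 1 \<and> (\<Sum>x\<in>X. p x *\<^sub>R x) = y}"
    by (intro closed_Collect_conj closed_Collect_eq continuous_intros coord)
  define W where "W = K \<inter> {p. (\<Sum>x\<in>X. p x) = 1 \<and> (\<Sum>x\<in>X. p x *\<^sub>R x) = y}"
  have W: "compact W"
    unfolding W_def using K closed by (rule compact_Int_closed)
  have W_sub: "W \<subseteq> admissible_weights X y"
    by (auto simp: W_def K_def admissible_weights_def PiE_def Pi_def)
  have restr: "restrict q X \<in> W \<and> F (restrict q X) = F q" if q: "q \<in> admissible_weights X y" for q
  proof -
    have "q x \<le> 1" if "x \<in> X" for x
      using q that assms(1) member_le_sum[of x X q] by (auto simp: admissible_weights_def)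
    then show ?thesis
      using q by (auto simp: W_def K_def F_def admissible_weights_def)
  qed
  have "W \<noteq> {}"
    using admissible_weights_nonempty[OF assms] restr by blast
  then obtain p where p: "p \<in> W" and min: "\<And>q. q \<in> W \<Longrightarrow> F p \<le> F q"
    using continuous_attains_inf[OF W _ continuous_on_subset[OF contF]] by auto
  have pA: "p \<in> admissible_weights X y"
    using p W_sub by blast
  have minA: "F p \<le> F q" if "q \<in> admissible_weights X y" for q
    using min restr[OF that] by force
  have "(INF p \<in> admissible_weights X y. F p) = F p"
    by (rule cInf_eq_minimum) (use pA minA in auto)
  moreover have F0: "F p \<ge> 0"
    using pA by (auto simp: F_def admissible_weights_def intro!: sum_nonneg)
  ultimately have rho: "rho X y = sqrt (F p)"
    by (simp add: rho_def F_def)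
  show "rho X y \<ge> 0"
    by (simp add: rho F0)
  show "\<exists>p \<in> admissible_weights X y. (rho X y)\<^sup>2 = (\<Sum>x\<in>X. p x * (norm (x - y))\<^sup>2)"
    using pA F0 by (auto simp: rho F_def)
  show "\<And>q. q \<in> admissible_weights X y \<Longrightarrow> (rho X y)\<^sup>2 \<le> (\<Sum>x\<in>X. q x * (norm (x - y))\<^sup>2)"
    using minA F0 by (simp add: rho F_def)
qed

end

theory Submission
  imports Defs
begin

text \<open>
  Let \<open>p\<close> be weights attaining \<open>\<rho>\<close>. In the product of the rescaled copies \<open>sqrt (p i) X\<close>, one
  for each \<open>i \<in> X\<close>, the diagonal points \<open>(sqrt (p i) x)\<^sub>i\<close> form an isometric copy of \<open>X\<close>, because
  the \<open>p i\<close> add up to 1. The point \<open>w = (sqrt (p i) i)\<^sub>i\<close> belongs to the same product, and its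
  squared distance from the diagonal point of \<open>x\<close> is \<open>\<Sum>i. p i \<parallel>x - i\<parallel>\<^sup>2 = \<parallel>x - y\<parallel>\<^sup>2 + \<rho>\<^sup>2\<close>: this is
  the parallel axis identity, since \<open>y\<close> is the barycentre of the weights. So the diagonal
  together with \<open>w\<close> is a copy of \<open>X\<close> with an apex at height \<open>\<rho>\<close> above \<open>y\<close>. A further product with
  a pair of points at distance \<open>sqrt (l\<^sup>2 - \<rho>\<^sup>2)\<close> raises the apex to height \<open>l\<close>.

  It remains to see that these products are Ramsey. This is the product theorem for Ramsey sets
  (\<open>pattern_ramsey_product\<close>): by compactness a Ramsey set is already forced inside a finite set
  \<open>T\<close>, and one colours a point \<open>v\<close> of the second space by the whole colouring \<open>t \<mapsto> c (t, v)\<close> of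
  \<open>T\<close>, of which there are finitely many.

  Everything is phrased with prescribed squared distances on an index set instead of point sets.
  Products then just add the squared distances, and subsets, isometric copies and diagonals all
  become reindexings.
\<close>

section \<open>Ramsey patterns of squared distances\<close>

definition monochromatic_copy ::
    "nat \<Rightarrow> 'i set \<Rightarrow> ('i \<Rightarrow> 'i \<Rightarrow> real) \<Rightarrow> ((nat \<Rightarrow> real) \<Rightarrow> nat) \<Rightarrow> ('i \<Rightarrow> nat \<Rightarrow> real) \<Rightarrow> bool" where
  "monochromatic_copy N I D c \<phi> \<longleftrightarrow>
     (\<forall>i\<in>I. \<forall>j\<in>I. (Rn_dist N (\<phi> i) (\<phi> j))\<^sup>2 = D i j) \<and> (\<exists>a. \<forall>i\<in>I. c (\<phi> i) = a)"

definition pattern_ramsey :: "'i set \<Rightarrow> ('i \<Rightarrow> 'i \<Rightarrow> real) \<Rightarrow> bool" where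
  "pattern_ramsey I D \<longleftrightarrow>
     (\<forall>k\<ge>1. \<exists>N. \<forall>c \<in> Rn N \<rightarrow> {..<k}. \<exists>\<phi> \<in> I \<rightarrow> Rn N. monochromatic_copy N I D c \<phi>)"

lemma Rn_dist_squared: "(Rn_dist N u v)\<^sup>2 = (\<Sum>i<N. (u i - v i)\<^sup>2)"
  by (simp add: Rn_dist_def L2_set_def sum_nonneg)

lemma Rn_dist_nonneg: "Rn_dist N u v \<ge> 0"
  by (simp add: Rn_dist_def)

lemma euclidean_ramsey_iff_pattern:
  "euclidean_ramsey X \<longleftrightarrow> finite X \<and> pattern_ramsey X (\<lambda>x x'. (dist x x')\<^sup>2)"
proof -
  have "(Rn_dist N u v)\<^sup>2 = (dist x x')\<^sup>2 \<longleftrightarrow> Rn_dist N u v = dist x x'"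
    for N u v and x x' :: 'a
    by (simp add: Rn_dist_nonneg power2_eq_iff_nonneg)
  then show ?thesis
    by (simp add: euclidean_ramsey_def pattern_ramsey_def monochromatic_copy_def)
qed

text \<open>
  Compose a copy of \<open>I\<close> with \<open>f\<close>. This covers both the passage to a subset and the embedding of a
  factor as the diagonal of a power.
\<close>

lemma pattern_ramsey_reindex:
  assumes "pattern_ramsey I D" and f: "f \<in> J \<rightarrow> I"
    and E: "\<And>a b. a \<in> J \<Longrightarrow> b \<in> J \<Longrightarrow> E a b = D (f a) (f b)"
  shows "pattern_ramsey J E"
  unfolding pattern_ramsey_def
proof (intro allI impI)
  fix k :: nat assume "k \<ge> 1"
  then obtain N where N: "\<forall>c \<in> Rn N \<rightarrow> {..<k}. \<exists>\<phi> \<in> I \<rightarrow> Rn N. monochromatic_copy N I D c \<phi>"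
    using assms(1) unfolding pattern_ramsey_def by presburger
  show "\<exists>N. \<forall>c \<in> Rn N \<rightarrow> {..<k}. \<exists>\<phi> \<in> J \<rightarrow> Rn N. monochromatic_copy N J E c \<phi>"
  proof (intro exI[of _ N] ballI)
    fix c assume "c \<in> Rn N \<rightarrow> {..<k}"
    from bspec[OF N this] obtain \<phi> a where "\<phi> \<in> I \<rightarrow> Rn N"
      "\<forall>i\<in>I. \<forall>j\<in>I. (Rn_dist N (\<phi> i) (\<phi> j))\<^sup>2 = D i j" "\<forall>i\<in>I. c (\<phi> i) = a"
      unfolding monochromatic_copy_def by blast
    then show "\<exists>\<phi> \<in> J \<rightarrow> Rn N. monochromatic_copy N J E c \<phi>"
      using f E by (intro bexI[of _ "\<phi> \<circ> f"]) (auto simp: Pi_iff monochromatic_copy_def)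
  qed
qed

text \<open>Colour \<open>v\<close> with the colour of \<open>s v\<close>.\<close>

lemma pattern_ramsey_scale:
  assumes "pattern_ramsey I D"
  shows "pattern_ramsey I (\<lambda>i j. s\<^sup>2 * D i j)"
  unfolding pattern_ramsey_def
proof (intro allI impI)
  fix k :: nat assume "k \<ge> 1"
  then obtain N where N: "\<forall>c \<in> Rn N \<rightarrow> {..<k}. \<exists>\<phi> \<in> I \<rightarrow> Rn N. monochromatic_copy N I D c \<phi>"
    using assms(1) unfolding pattern_ramsey_def by presburger
  show "\<exists>N. \<forall>c \<in> Rn N \<rightarrow> {..<k}. \<exists>\<phi> \<in> I \<rightarrow> Rn N. monochromatic_copy N I (\<lambda>i j. s\<^sup>2 * D i j) c \<phi>"
  proof (intro exI[of _ N] ballI)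
    fix c assume c: "c \<in> Rn N \<rightarrow> {..<k}"
    define m where "m v = (\<lambda>n. s * v n)" for v :: "nat \<Rightarrow> real"
    have m: "m v \<in> Rn N" if "v \<in> Rn N" for v
      using that by (simp add: m_def Rn_def)
    have dist_m: "(Rn_dist N (m u) (m v))\<^sup>2 = s\<^sup>2 * (Rn_dist N u v)\<^sup>2" for u v
      by (simp add: m_def Rn_dist_squared sum_distrib_left
          flip: power_mult_distrib right_diff_distrib)
    have "(\<lambda>v. c (m v)) \<in> Rn N \<rightarrow> {..<k}"
      using c m by auto
    from bspec[OF N this] obtain \<phi> a where "\<phi> \<in> I \<rightarrow> Rn N"
      "\<forall>i\<in>I. \<forall>j\<in>I. (Rn_dist N (\<phi> i) (\<phi> j))\<^sup>2 = D i j" "\<forall>i\<in>I. c (m (\<phi> i)) = a"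
      unfolding monochromatic_copy_def by blast
    then show "\<exists>\<phi> \<in> I \<rightarrow> Rn N. monochromatic_copy N I (\<lambda>i j. s\<^sup>2 * D i j) c \<phi>"
      using m dist_m by (intro bexI[of _ "m \<circ> \<phi>"]) (auto simp: Pi_iff monochromatic_copy_def)
  qed
qed

text \<open>
  Among the \<open>k + 1\<close> vertices of a regular simplex two have the same one of \<open>k\<close> colours.
\<close>

lemma pattern_ramsey_pair:
  assumes "d \<ge> 0"
  shows "pattern_ramsey UNIV (\<lambda>b b' :: bool. if b = b' then 0 else d)"
  unfolding pattern_ramsey_def
proof (intro allI impI)
  fix k :: nat assume "k \<ge> 1"
  define e where "e n = (\<lambda>i. if i = n then sqrt (d / 2) else 0)" for n :: nat
  have e: "e n \<in> Rn (Suc k)" if "n \<le> k" for n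
    using that by (simp add: e_def Rn_def)
  have dist_e: "(Rn_dist (Suc k) (e m) (e n))\<^sup>2 = d" if "m \<le> k" "n \<le> k" "m \<noteq> n" for m n
  proof -
    have "(e m i - e n i)\<^sup>2 = (if i = m then d / 2 else 0) + (if i = n then d / 2 else 0)" for i
      using that(3) assms by (simp add: e_def)
    then show ?thesis
      using that(1,2) by (simp add: Rn_dist_squared sum.distrib del: sum.lessThan_Suc)
  qed
  let ?D = "\<lambda>b b' :: bool. if b = b' then 0 else d"
  show "\<exists>N. \<forall>c \<in> Rn N \<rightarrow> {..<k}. \<exists>\<phi> \<in> UNIV \<rightarrow> Rn N. monochromatic_copy N UNIV ?D c \<phi>"
  proof (intro exI[of _ "Suc k"] ballI)
    fix c assume c: "c \<in> Rn (Suc k) \<rightarrow> {..<k}"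
    have "(\<lambda>n. c (e n)) ` {..k} \<subseteq> {..<k}"
      using c e by auto
    then have "card ((\<lambda>n. c (e n)) ` {..k}) \<le> card {..<k}"
      by (rule card_mono[rotated]) simp
    then have "\<not> inj_on (\<lambda>n. c (e n)) {..k}"
      by (intro pigeonhole) simp
    then obtain m n where mn: "m \<le> k" "n \<le> k" "m \<noteq> n" "c (e m) = c (e n)"
      unfolding inj_on_def by blast
    let ?\<phi> = "\<lambda>b. if b then e m else e n"
    have "(Rn_dist (Suc k) (?\<phi> b) (?\<phi> b'))\<^sup>2 = ?D b b'" for b b'
      using mn(1-3) dist_e[of m n] dist_e[of n m]
      by (cases b; cases b') (simp_all add: Rn_dist_squared del: sum.lessThan_Suc)
    moreover have "c (?\<phi> b) = c (e n)" for b
      using mn(4) by simp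
    ultimately have "monochromatic_copy (Suc k) UNIV ?D c ?\<phi>"
      unfolding monochromatic_copy_def by blast
    moreover have "?\<phi> \<in> UNIV \<rightarrow> Rn (Suc k)"
      using mn(1,2) e by simp
    ultimately show "\<exists>\<phi> \<in> UNIV \<rightarrow> Rn (Suc k). monochromatic_copy (Suc k) UNIV ?D c \<phi>"
      by (rule bexI)
  qed
qed

section \<open>Compactness\<close>

text \<open>
  The colourings of \<open>V\<close> form a compact space by Tychonoff's theorem, and being constant on a given
  finite set is an open condition. The sets of \<open>F\<close> thus give an open cover, and a finite
  subcover is what is wanted.
\<close>

lemma monochromatic_compactness:
  fixes k :: nat
  assumes k: "k \<ge> 1" and F: "\<And>S. S \<in> F \<Longrightarrow> finite S \<and> S \<subseteq> V"
    and mono: "\<And>c. c \<in> V \<rightarrow> {..<k} \<Longrightarrow> \<exists>S\<in>F. \<exists>a. \<forall>v\<in>S. c v = a"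
  obtains G where "finite G" "G \<subseteq> F"
    "\<And>c. c \<in> \<Union>G \<rightarrow> {..<k} \<Longrightarrow> \<exists>S\<in>G. \<exists>a. \<forall>v\<in>S. c v = a"
proof -
  define C where "C = product_topology (\<lambda>_. discrete_topology {..<k}) V"
  define U where "U S = (\<Union>a<k. PiE V (\<lambda>v. if v \<in> S then {a} else {..<k}))" for S
  have topC: "topspace C = PiE V (\<lambda>_. {..<k})"
    by (simp add: C_def)
  have "compact_space C"
    by (simp add: C_def compact_space_product_topology compact_space_discrete_topology)
  moreover have "openin C (U S)" if "S \<in> F" for S
    unfolding U_def C_def
  proof (intro openin_Union ballI; clarify)
    fix a assume "a < k"
    have "finite {v. (if v \<in> S then {a} else {..<k}) \<noteq> {..<k}}"
      by (rule finite_subset[of _ S]) (use F[OF that] in \<open>auto split: if_splits\<close>)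
    then show "openin (product_topology (\<lambda>_. discrete_topology {..<k}) V)
        (PiE V (\<lambda>v. if v \<in> S then {a} else {..<k}))"
      using \<open>a < k\<close> by (intro product_topology_basis) auto
  qed
  moreover have "topspace C \<subseteq> \<Union>(U ` F)"
  proof
    fix c assume c: "c \<in> topspace C"
    then obtain S a where S: "S \<in> F" "\<forall>v\<in>S. c v = a"
      using mono[of c] by (auto simp: topC)
    \<comment> \<open>If \<open>S\<close> is empty, \<open>a\<close> need not be a colour, and colour 0 serves instead.\<close>
    obtain b where "b < k" "\<forall>v\<in>S. c v = b"
    proof (cases "S = {}")
      case True
      with k that[of 0] show ?thesis by simp
    next
      case False
      with S c F[OF S(1)] have "a < k"
        by (fastforce simp: topC PiE_iff)
      with S that show ?thesis by blast
    qed
    then have "c \<in> U S"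
      using c by (auto simp: U_def topC PiE_iff)
    with S(1) show "c \<in> \<Union>(U ` F)" by blast
  qed
  ultimately obtain \<U> where "finite \<U>" "\<U> \<subseteq> U ` F" "topspace C \<subseteq> \<Union>\<U>"
    unfolding compact_space_alt by (metis (no_types, lifting) image_iff)
  then obtain G where G: "finite G" "G \<subseteq> F" "topspace C \<subseteq> \<Union>(U ` G)"
    by (metis finite_subset_image)
  show thesis
  proof (rule that[OF G(1,2)])
    fix c assume c: "c \<in> \<Union>G \<rightarrow> {..<k}"
    define c' where "c' = restrict (\<lambda>v. if v \<in> \<Union>G then c v else 0) V"
    have "c' \<in> topspace C"
      using c k by (auto simp: topC c'_def PiE_iff)
    with G(3) obtain S a where S: "S \<in> G" "c' \<in> PiE V (\<lambda>v. if v \<in> S then {a} else {..<k})"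
      by (auto simp: U_def)
    have "c v = a" if "v \<in> S" for v
    proof -
      have "v \<in> V"
        using F G(2) S(1) that by blast
      then have "c' v = a"
        using S(2) that by (auto simp: PiE_iff)
      then show ?thesis
        using \<open>v \<in> V\<close> S(1) that by (auto simp: c'_def split: if_splits)
    qed
    with S(1) show "\<exists>S\<in>G. \<exists>a. \<forall>v\<in>S. c v = a" by blast
  qed
qed

text \<open>Compactness is applied to the point sets of all copies of the pattern in \<open>\<real>\<^sup>N\<close>.\<close>

lemma pattern_ramsey_finite_witness:
  fixes k :: nat
  assumes ram: "pattern_ramsey I D" and "finite I" and k: "k \<ge> 1"
  obtains N T where "finite T" "T \<subseteq> Rn N"
    "\<forall>c \<in> T \<rightarrow> {..<k}. \<exists>\<phi> \<in> I \<rightarrow> T. monochromatic_copy N I D c \<phi>"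
proof -
  obtain N where N: "\<forall>c \<in> Rn N \<rightarrow> {..<k}. \<exists>\<phi> \<in> I \<rightarrow> Rn N. monochromatic_copy N I D c \<phi>"
    using ram k unfolding pattern_ramsey_def by presburger
  define F where "F = {\<phi> ` I |\<phi>. \<phi> \<in> I \<rightarrow> Rn N \<and>
    (\<forall>i\<in>I. \<forall>j\<in>I. (Rn_dist N (\<phi> i) (\<phi> j))\<^sup>2 = D i j)}"
  have fin: "finite S \<and> S \<subseteq> Rn N" if "S \<in> F" for S
    using that \<open>finite I\<close> by (auto simp: F_def)
  have "\<exists>S\<in>F. \<exists>a. \<forall>v\<in>S. c v = a" if c: "c \<in> Rn N \<rightarrow> {..<k}" for c
  proof -
    from bspec[OF N c] obtain \<phi> a where "\<phi> \<in> I \<rightarrow> Rn N"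
      "\<forall>i\<in>I. \<forall>j\<in>I. (Rn_dist N (\<phi> i) (\<phi> j))\<^sup>2 = D i j" "\<forall>i\<in>I. c (\<phi> i) = a"
      unfolding monochromatic_copy_def by blast
    then have "\<phi> ` I \<in> F" "\<forall>v\<in>\<phi> ` I. c v = a"
      by (auto simp: F_def)
    then show ?thesis by blast
  qed
  from monochromatic_compactness[OF k fin this] obtain G where G: "finite G" "G \<subseteq> F"
    and mono: "\<And>c. c \<in> \<Union>G \<rightarrow> {..<k} \<Longrightarrow> \<exists>S\<in>G. \<exists>a. \<forall>v\<in>S. c v = a"
    by blast
  show thesis
  proof (rule that[of "\<Union>G" N])
    show "finite (\<Union>G)" "\<Union>G \<subseteq> Rn N"
      using G fin by blast+
    show "\<forall>c \<in> \<Union>G \<rightarrow> {..<k}. \<exists>\<phi> \<in> I \<rightarrow> \<Union>G. monochromatic_copy N I D c \<phi>"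
    proof
      fix c assume "c \<in> \<Union>G \<rightarrow> {..<k}"
      from mono[OF this] obtain S a where S: "S \<in> G" "\<forall>v\<in>S. c v = a" by blast
      with G(2) obtain \<phi> where \<phi>: "S = \<phi> ` I"
        "\<forall>i\<in>I. \<forall>j\<in>I. (Rn_dist N (\<phi> i) (\<phi> j))\<^sup>2 = D i j"
        unfolding F_def by blast
      then show "\<exists>\<phi> \<in> I \<rightarrow> \<Union>G. monochromatic_copy N I D c \<phi>"
        using S by (intro bexI[of _ \<phi>]) (auto simp: monochromatic_copy_def)
    qed
  qed
qed

section \<open>Products of Ramsey patterns\<close>

definition join :: "nat \<Rightarrow> (nat \<Rightarrow> real) \<Rightarrow> (nat \<Rightarrow> real) \<Rightarrow> nat \<Rightarrow> real" where
  "join N u v = (\<lambda>i. if i < N then u i else v (i - N))"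

lemma join_in_Rn: "v \<in> Rn M \<Longrightarrow> join N u v \<in> Rn (N + M)"
  by (simp add: join_def Rn_def)

lemma Rn_dist_join:
  "(Rn_dist (N + M) (join N u v) (join N u' v'))\<^sup>2 = (Rn_dist N u u')\<^sup>2 + (Rn_dist M v v')\<^sup>2"
proof -
  have split: "(\<Sum>i<N + M. g i) = (\<Sum>i<N. g i) + (\<Sum>i<M. g (N + i))" for g :: "nat \<Rightarrow> real"
    by (induction M) (simp_all add: add.assoc)
  show ?thesis
    unfolding Rn_dist_squared split by (simp add: join_def)
qed

text \<open>
  Take a finite set \<open>T\<close> that forces \<open>I\<close> under every colouring. In the second space, colour \<open>v\<close> by
  the restriction of the colouring to the slice \<open>T \<times> {v}\<close>. A copy of \<open>J\<close> that is monochromatic for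
  this has the same slice above each of its points, so a copy of \<open>I\<close> that is monochromatic in
  one slice is so in all of them, with the same colour.
\<close>

lemma pattern_ramsey_product:
  assumes I: "pattern_ramsey I D" and fin: "finite I" and J: "pattern_ramsey J E"
  shows "pattern_ramsey (I \<times> J) (\<lambda>(i, j) (i', j'). D i i' + E j j')"
  unfolding pattern_ramsey_def
proof (intro allI impI)
  fix k :: nat assume k: "k \<ge> 1"
  obtain N T where T: "finite T" "T \<subseteq> Rn N" and
    forced: "\<forall>c \<in> T \<rightarrow> {..<k}. \<exists>\<phi> \<in> I \<rightarrow> T. monochromatic_copy N I D c \<phi>"
    using pattern_ramsey_finite_witness[OF I fin k] by metis
  define P where "P = PiE T (\<lambda>_. {..<k})"
  have "finite P"
    using T(1) by (simp add: P_def finite_PiE)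
  then obtain h where h: "bij_betw h P {..<card P}"
    using ex_bij_betw_finite_nat[of P] by (auto simp: lessThan_atLeast0)
  have "P \<noteq> {}"
    using k by (auto simp: P_def PiE_eq_empty_iff lessThan_empty_iff)
  with \<open>finite P\<close> have "card P \<ge> 1"
    by (simp add: Suc_leI card_gt_0_iff)
  then obtain M where M: "\<forall>c \<in> Rn M \<rightarrow> {..<card P}. \<exists>\<psi> \<in> J \<rightarrow> Rn M. monochromatic_copy M J E c \<psi>"
    using J unfolding pattern_ramsey_def by presburger
  let ?DE = "\<lambda>(i, j) (i', j'). D i i' + E j j'"
  show "\<exists>N. \<forall>c \<in> Rn N \<rightarrow> {..<k}. \<exists>\<phi> \<in> I \<times> J \<rightarrow> Rn N. monochromatic_copy N (I \<times> J) ?DE c \<phi>"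
  proof (intro exI[of _ "N + M"] ballI)
    fix c assume c: "c \<in> Rn (N + M) \<rightarrow> {..<k}"
    define slice where "slice v = (\<lambda>t\<in>T. c (join N t v))" for v
    have slice: "slice v \<in> P" if "v \<in> Rn M" for v
      using c join_in_Rn[OF that] by (auto simp: slice_def P_def)
    have "h \<circ> slice \<in> Rn M \<rightarrow> {..<card P}"
      using slice h by (auto simp: bij_betw_def)
    from bspec[OF M this] obtain \<psi> b where \<psi>: "\<psi> \<in> J \<rightarrow> Rn M"
      "\<forall>i\<in>J. \<forall>j\<in>J. (Rn_dist M (\<psi> i) (\<psi> j))\<^sup>2 = E i j" "\<forall>j\<in>J. h (slice (\<psi> j)) = b"
      unfolding monochromatic_copy_def comp_def by blast
    have same: "slice (\<psi> j) = slice (\<psi> j')" if "j \<in> J" "j' \<in> J" for j j'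
      using \<psi> that slice h by (metis Pi_mem bij_betw_def inj_onD)
    obtain s where s: "s \<in> P" "\<forall>j\<in>J. slice (\<psi> j) = s"
    proof (cases "J = {}")
      case True
      then show ?thesis using that \<open>P \<noteq> {}\<close> by blast
    next
      case False
      then obtain j0 where "j0 \<in> J" by blast
      then show ?thesis
        using that[of "slice (\<psi> j0)"] same slice \<psi>(1) by blast
    qed
    have "s \<in> T \<rightarrow> {..<k}"
      using s(1) by (auto simp: P_def)
    from bspec[OF forced this] obtain \<phi> a where \<phi>: "\<phi> \<in> I \<rightarrow> T"
      "\<forall>i\<in>I. \<forall>j\<in>I. (Rn_dist N (\<phi> i) (\<phi> j))\<^sup>2 = D i j" "\<forall>i\<in>I. s (\<phi> i) = a"
      unfolding monochromatic_copy_def by blast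
    have "c (join N (\<phi> i) (\<psi> j)) = a" if "i \<in> I" "j \<in> J" for i j
    proof -
      have "c (join N (\<phi> i) (\<psi> j)) = slice (\<psi> j) (\<phi> i)"
        using \<phi>(1) that by (auto simp: slice_def)
      then show ?thesis
        using s(2) \<phi>(3) that by simp
    qed
    then have "monochromatic_copy (N + M) (I \<times> J) ?DE c (\<lambda>(i, j). join N (\<phi> i) (\<psi> j))"
      using \<phi>(2) \<psi>(2) by (auto simp: monochromatic_copy_def Rn_dist_join)
    then show "\<exists>\<phi> \<in> I \<times> J \<rightarrow> Rn (N + M). monochromatic_copy (N + M) (I \<times> J) ?DE c \<phi>"
      using \<psi>(1) by (intro bexI[of _ "\<lambda>(i, j). join N (\<phi> i) (\<psi> j)"])
        (auto intro!: join_in_Rn)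
  qed
qed

text \<open>The factor at \<open>a\<close> is scaled by \<open>sqrt (p a)\<close>, which turns its squared distances into \<open>p a * D\<close>.\<close>

lemma pattern_ramsey_weighted_power:
  assumes "finite A" and "\<And>a. a \<in> A \<Longrightarrow> p a \<ge> 0" and I: "pattern_ramsey I D" "finite I"
  shows "pattern_ramsey (A \<rightarrow> I) (\<lambda>f g. \<Sum>a\<in>A. p a * D (f a) (g a))"
  using assms(1,2)
proof (induction A)
  case empty
  \<comment> \<open>The empty product is a single point, which is a pair at distance 0.\<close>
  show ?case
    by (rule pattern_ramsey_reindex[OF pattern_ramsey_pair[of 0], of "\<lambda>_. True"]) auto
next
  case (insert a A)
  have "pattern_ramsey I (\<lambda>i j. (sqrt (p a))\<^sup>2 * D i j)"
    using I(1) by (rule pattern_ramsey_scale)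
  moreover have "pattern_ramsey (A \<rightarrow> I) (\<lambda>f g. \<Sum>a\<in>A. p a * D (f a) (g a))"
    using insert by simp
  ultimately show ?case
    by (rule pattern_ramsey_reindex[OF pattern_ramsey_product[OF _ I(2)], of _ _ _ "\<lambda>f. (f a, f)"])
       (use insert in auto)
qed

section \<open>One-point extensions\<close>

text \<open>The cross terms cancel, because the deviations from the barycentre average to zero.\<close>

lemma parallel_axis_identity:
  fixes y z :: "'a::real_inner"
  assumes "(\<Sum>x\<in>X. p x) = 1" and "(\<Sum>x\<in>X. p x *\<^sub>R x) = y"
  shows "(\<Sum>x\<in>X. p x * (dist z x)\<^sup>2) = (dist z y)\<^sup>2 + (\<Sum>x\<in>X. p x * (norm (x - y))\<^sup>2)"
proof -
  have "(\<Sum>x\<in>X. p x *\<^sub>R (x - y)) = 0"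
    using assms by (simp add: scaleR_diff_right sum_subtractf flip: scaleR_sum_left)
  then have cross: "(\<Sum>x\<in>X. p x * ((z - y) \<bullet> (x - y))) = 0"
    by (metis (no_types, lifting) inner_scaleR_right inner_sum_right inner_zero_right sum.cong)
  have "p x * (dist z x)\<^sup>2 =
      p x * (dist z y)\<^sup>2 - 2 * (p x * ((z - y) \<bullet> (x - y))) + p x * (norm (x - y))\<^sup>2" for x
  proof -
    have "(dist z x)\<^sup>2 = (norm ((z - y) - (x - y)))\<^sup>2"
      by (simp add: dist_norm)
    also have "\<dots> = (dist z y)\<^sup>2 - 2 * ((z - y) \<bullet> (x - y)) + (norm (x - y))\<^sup>2"
      unfolding dist_norm power2_norm_eq_inner by (simp add: inner_diff inner_commute)
    finally show ?thesis
      by (simp only: distrib_left right_diff_distrib mult.left_commute)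
  qed
  then show ?thesis
    using cross assms(1)
    by (simp add: sum.distrib sum_subtractf flip: sum_distrib_left sum_distrib_right)
qed

theorem proposition2p1:
  fixes X :: "'a::euclidean_space set" and y :: 'a and l :: real
  assumes "euclidean_ramsey X"
    and "y \<in> convex hull X"
    and "l \<noteq> 0"
    and "\<bar>l\<bar> \<ge> rho X y"
  shows "euclidean_ramsey ((X \<times> {0}) \<union> {(y, l)})"
proof -
  have fin: "finite X" and X: "pattern_ramsey X (\<lambda>x x'. (dist x x')\<^sup>2)"
    using assms(1) by (auto simp: euclidean_ramsey_iff_pattern)
  obtain p where p: "p \<in> admissible_weights X y"
    and rho: "(rho X y)\<^sup>2 = (\<Sum>x\<in>X. p x * (norm (x - y))\<^sup>2)"
    using rho_minimum(2)[OF fin assms(2)] by blast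
  have p0: "\<And>x. x \<in> X \<Longrightarrow> p x \<ge> 0" and p1: "(\<Sum>x\<in>X. p x) = 1"
    and py: "(\<Sum>x\<in>X. p x *\<^sub>R x) = y"
    using p by (auto simp: admissible_weights_def)
  define h where "h = l\<^sup>2 - (rho X y)\<^sup>2"
  have "h \<ge> 0"
    using assms(4) rho_minimum(1)[OF fin assms(2)]
    by (simp add: h_def abs_le_square_iff[symmetric])
  let ?E = "\<lambda>(b, f) (b', g).
    (if b = b' then 0 else h) + (\<Sum>x\<in>X. p x * (dist (f x) (g x))\<^sup>2)"
  have prod: "pattern_ramsey ((UNIV :: bool set) \<times> (X \<rightarrow> X)) ?E"
    using pattern_ramsey_pair[OF \<open>h \<ge> 0\<close>] pattern_ramsey_weighted_power[OF fin p0 X fin]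
    by (intro pattern_ramsey_product) auto
  \<comment> \<open>Points of \<open>X\<close> go to the diagonal, the apex goes to the point whose \<open>x\<close>-th coordinate is \<open>x\<close>.\<close>
  define place where
    "place z = (if snd z = 0 then (False, \<lambda>_. fst z) else (True, \<lambda>x. x))" for z :: "'a \<times> real"
  have apex: "(\<Sum>x\<in>X. p x * (dist z x)\<^sup>2) + h = (dist z y)\<^sup>2 + l\<^sup>2" for z
    by (simp add: parallel_axis_identity[OF p1 py] h_def rho)
  have diagonal: "(\<Sum>x\<in>X. p x * (dist z z')\<^sup>2) = (dist z z')\<^sup>2" for z z'
    by (simp add: p1 flip: sum_distrib_right)
  have "pattern_ramsey ((X \<times> {0}) \<union> {(y, l)}) (\<lambda>u v. (dist u v)\<^sup>2)"
  proof (rule pattern_ramsey_reindex[OF prod])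
    show "place \<in> (X \<times> {0}) \<union> {(y, l)} \<rightarrow> UNIV \<times> (X \<rightarrow> X)"
      using assms(3) by (auto simp: place_def)
    fix u v assume "u \<in> (X \<times> {0}) \<union> {(y, l)}" "v \<in> (X \<times> {0}) \<union> {(y, l)}"
    then consider x x' where "u = (x, 0)" "v = (x', 0)" | x where "u = (x, 0)" "v = (y, l)"
      | x where "u = (y, l)" "v = (x, 0)" | "u = (y, l)" "v = (y, l)"
      by auto
    then show "(dist u v)\<^sup>2 = ?E (place u) (place v)"
    proof cases
      case 1
      then show ?thesis by (simp add: place_def dist_Pair_Pair diagonal)
    next
      case (2 x)
      then show ?thesis
        using apex[of x] assms(3) by (simp add: place_def dist_Pair_Pair dist_real_def)
    next
      case (3 x)
      then show ?thesis
        using apex[of x] assms(3)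
        by (simp add: place_def dist_Pair_Pair dist_real_def dist_commute)
    next
      case 4
      then show ?thesis by (simp add: place_def assms(3))
    qed
  qed
  then show ?thesis
    using fin by (simp add: euclidean_ramsey_iff_pattern)
qed

end
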